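(* Let $p\ge1$. For every $t\ge0$ let $m_t,L_t>0$, $\sigma_t\ge0$, $c_t\ge0$, $\delta_t\ge0$, $\alpha_t\ge0$. Consider the iteration $x_{t+1}=x_t-\alpha_t(F_t(x_t)+v_t)$ in $\mathbb R^p$, where $F_t:\mathbb R^p\to\mathbb R^p$ and $x_t^*$ satisfies $F_t(x_t^* )=0$. For all $t$ assume: (i) $F_t$ is $m_t$-strongly monotone; (ii) $F_t$ is $L_t$-Lipschitz, i.e. $\|F_t(x)-F_t(\tilde x)\|\le L_t\|x-\tilde x\|$ for all $x,\tilde x\in\mathbb R^p$; (iii) $\|v_t\|^2\le\delta_t^2\|F_t(x_t)\|^2+c_t^2$; (iv) $\|x_{t+1}^*-x_t^*\|\le\sigma_t$. If there exist non-negative scalars $(\rho_t,\lambda_t^{(1)},\lambda_t^{(2)},\lambda_t^{(3)},\lambda_t^{(4)})$ such that $$\begin{bmatrix}1-\rho_t^2+\lambda_t^{(4)}L_t^2-2\lambda_t^{(1)}m_t&\lambda_t^{(1)}-\alpha_t&1&-\alpha_t\\ \lambda_t^{(1)}-\alpha_t&\alpha_t^2-\lambda_t^{(4)}+\delta_t^2\lambda_t^{(3)}&-\alpha_t&\alpha_t^2\\1&-\alpha_t&1-\lambda_t^{(2)}&-\alpha_t\\-\alpha_t&\alpha_t^2&-\alpha_t&\alpha_t^2-\lambda_t^{(3)}\end{bmatrix}\preceq0,$$ then $\|x_{t+1}-x_{t+1}^*\|^2\le\rho_t^2\|x_t-x_t^*\|^2+\lambda_t^{(2)}\sigma_t^2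+\lambda_t^{(3)}c_t^2$.
   Context: $F_t$ is $m_t$-strongly monotone if $(F_t(x)-F_t(\tilde x))^T(x-\tilde x)\ge m_t\|x-\tilde x\|^2$ for all $x,\tilde x\in\mathbb R^p$. $P\preceq0$ means the symmetric matrix $P$ is negative semidefinite; norms are Euclidean. *)

theory Defs
  imports "HOL-Analysis.Analysis"
begin

definition strongly_monotone :: "real \<Rightarrow> ('a::real_inner \<Rightarrow> 'a) \<Rightarrow> bool" where
  "strongly_monotone m F \<longleftrightarrow>
     (\<forall>x y. (F x - F y) \<bullet> (x - y) \<ge> m * (norm (x - y))\<^sup>2)"

definition negative_semidefinite :: "real ^ 'n ^ 'n \<Rightarrow> bool" where
  "negative_semidefinite P \<longleftrightarrow> transpose P = P \<and> (\<forall>z. z \<bullet> (P *v z) \<le> 0)"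

end

theory Submission
  imports Defs
begin

text \<open>
  A negative semidefinite matrix \<open>P\<close> satisfies \<open>(\<Sum>i j. P $ i $ j * (u i \<bullet> u j)) \<le> 0\<close> for all
  families \<open>u\<close> of vectors in a Euclidean space, as one sees coordinate by coordinate. Apply this to
  \<open>e = x t - xstar t\<close>, \<open>f = F t (x t)\<close>, \<open>w = xstar t - xstar (Suc t)\<close> and \<open>n = v t\<close>. Since
  \<open>x (Suc t) - xstar (Suc t) = e - \<alpha> f + w - \<alpha> n\<close>, the matrix inequality is an S-procedure: it
  bounds the squared norm of the new error minus \<open>\<rho>\<^sup>2\<close> times that of \<open>e\<close>, with multiplier \<open>lam1\<close>
  for strong monotonicity, \<open>lam2\<close> for the drift, \<open>lam3\<close> for the noise and \<open>lam4\<close> for the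
  Lipschitz bound.
\<close>

lemma vector_4:
  fixes a b c d :: "'a::zero"
  shows "(vector [a, b, c, d] :: 'a ^ 4) $ 1 = a"
    and "(vector [a, b, c, d] :: 'a ^ 4) $ 2 = b"
    and "(vector [a, b, c, d] :: 'a ^ 4) $ 3 = c"
    and "(vector [a, b, c, d] :: 'a ^ 4) $ 4 = d"
  by (simp_all add: vector_def)

text \<open>Expanding each \<open>u i \<bullet> u j\<close> over the orthonormal
  \<open>Basis\<close> splits the double sum into one quadratic form of \<open>P\<close> per basis
  vector \<open>b\<close>, evaluated at the scalar vector of \<open>b\<close>-coordinates of the
  \<open>u i\<close>.\<close>

lemma negative_semidefinite_sum_inner_le_0:
  fixes P :: "real ^ 'n ^ 'n" and u :: "'n \<Rightarrow> 'a::euclidean_space"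
  assumes "negative_semidefinite P"
  shows "(\<Sum>i\<in>UNIV. \<Sum>j\<in>UNIV. P $ i $ j * (u i \<bullet> u j)) \<le> 0"
proof -
  have "(\<Sum>i\<in>UNIV. \<Sum>j\<in>UNIV. P $ i $ j * (u i \<bullet> u j))
      = (\<Sum>i\<in>UNIV. \<Sum>j\<in>UNIV. \<Sum>b\<in>Basis. P $ i $ j * ((u i \<bullet> b) * (u j \<bullet> b)))"
    by (simp add: sum_distrib_left euclidean_inner[of "u _" "u _"])
  also have "\<dots> = (\<Sum>i\<in>UNIV. \<Sum>b\<in>Basis. \<Sum>j\<in>UNIV. P $ i $ j * ((u i \<bullet> b) * (u j \<bullet> b)))"
    by (intro sum.cong refl sum.swap)
  also have "\<dots> = (\<Sum>b\<in>Basis. \<Sum>i\<in>UNIV. \<Sum>j\<in>UNIV. P $ i $ j * ((u i \<bullet> b) * (u j \<bullet> b)))"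
    by (rule sum.swap)
  also have "\<dots> = (\<Sum>b\<in>Basis. (\<chi> i. u i \<bullet> b) \<bullet> (P *v (\<chi> i. u i \<bullet> b)))"
    by (simp add: inner_vec_def matrix_vector_mult_def sum_distrib_left mult_ac)
  also have "\<dots> \<le> 0"
    using assms unfolding negative_semidefinite_def by (intro sum_nonpos) blast
  finally show ?thesis .
qed

theorem lemma3p5:
  fixes F :: "nat \<Rightarrow> real ^ 'p \<Rightarrow> real ^ 'p"
    and x xstar v :: "nat \<Rightarrow> real ^ 'p"
    and m L \<sigma> c \<delta> \<alpha> \<rho> lam1 lam2 lam3 lam4 :: "nat \<Rightarrow> real"
    and t :: nat
  assumes "\<And>s. m s > 0" and "\<And>s. L s > 0"
    and "\<And>s. \<sigma> s \<ge> 0" and "\<And>s. c s \<ge> 0" and "\<And>s. \<delta> s \<ge> 0" and "\<And>s. \<alpha> s \<ge> 0"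
    and iteration: "\<And>s. x (Suc s) = x s - \<alpha> s *\<^sub>R (F s (x s) + v s)"
    and root: "\<And>s. F s (xstar s) = 0"
    and "\<And>s. strongly_monotone (m s) (F s)"
    and "\<And>s. (L s)-lipschitz_on UNIV (F s)"
    and "\<And>s. (norm (v s))\<^sup>2 \<le> (\<delta> s)\<^sup>2 * (norm (F s (x s)))\<^sup>2 + (c s)\<^sup>2"
    and "\<And>s. norm (xstar (Suc s) - xstar s) \<le> \<sigma> s"
    and "\<rho> t \<ge> 0" and "lam1 t \<ge> 0" and "lam2 t \<ge> 0" and "lam3 t \<ge> 0" and "lam4 t \<ge> 0"
    and LMI: "negative_semidefinite (vector
      [vector [1 - (\<rho> t)\<^sup>2 + lam4 t * (L t)\<^sup>2 - 2 * lam1 t * m t, lam1 t - \<alpha> t, 1, - \<alpha> t],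
       vector [lam1 t - \<alpha> t, (\<alpha> t)\<^sup>2 - lam4 t + (\<delta> t)\<^sup>2 * lam3 t, - \<alpha> t, (\<alpha> t)\<^sup>2],
       vector [1, - \<alpha> t, 1 - lam2 t, - \<alpha> t],
       vector [- \<alpha> t, (\<alpha> t)\<^sup>2, - \<alpha> t, (\<alpha> t)\<^sup>2 - lam3 t]] :: real ^ 4 ^ 4)"
  shows "(norm (x (Suc t) - xstar (Suc t)))\<^sup>2
    \<le> (\<rho> t)\<^sup>2 * (norm (x t - xstar t))\<^sup>2 + lam2 t * (\<sigma> t)\<^sup>2 + lam3 t * (c t)\<^sup>2"
proof -
  define e f w n where "e = x t - xstar t" and "f = F t (x t)"
    and "w = xstar t - xstar (Suc t)" and "n = v t"
  \<comment> \<open>The order e, f, w, n matches the rows of the matrix in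
    \<open>LMI\<close>.\<close>
  define u :: "4 \<Rightarrow> real ^ 'p" where "u i = vector [e, f, w, n] $ i" for i
  note u = u_def vector_4
  have step: "x (Suc t) - xstar (Suc t) = e - \<alpha> t *\<^sub>R f + w - \<alpha> t *\<^sub>R n"
    by (simp add: iteration e_def f_def w_def n_def algebra_simps)
  have mono: "m t * (norm e)\<^sup>2 \<le> f \<bullet> e"
    using assms(9)[of t] root[of t]
    unfolding strongly_monotone_def e_def f_def by (metis diff_zero)
  have "norm f \<le> L t * norm e"
    using lipschitz_onD[OF assms(10)[of t], of "x t" "xstar t"] root[of t]
    by (simp add: dist_norm e_def f_def)
  then have lip: "(norm f)\<^sup>2 \<le> (L t)\<^sup>2 * (norm e)\<^sup>2"
    by (metis norm_ge_zero power_mono power_mult_distrib)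
  have noise: "(norm n)\<^sup>2 \<le> (\<delta> t)\<^sup>2 * (norm f)\<^sup>2 + (c t)\<^sup>2"
    using assms(11)[of t] by (simp add: n_def f_def)
  have drift: "(norm w)\<^sup>2 \<le> (\<sigma> t)\<^sup>2"
    using assms(12)[of t] by (simp add: w_def norm_minus_commute power_mono)
  \<comment> \<open>The matrix is g g^T plus multiplier terms, with g = (1, -\<alpha>, 1, -\<alpha>)
    the coefficients in \<open>step\<close>; g g^T yields the squared norm of the new error. The
    factor 2 of \<open>lam1 t\<close> comes from its two symmetric off-diagonal entries.\<close>
  have "(norm (x (Suc t) - xstar (Suc t)))\<^sup>2 - (\<rho> t)\<^sup>2 * (norm e)\<^sup>2
      + lam4 t * ((L t)\<^sup>2 * (norm e)\<^sup>2 - (norm f)\<^sup>2) + 2 * lam1 t * (f \<bullet> e - m t * (norm e)\<^sup>2)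
      - lam2 t * (norm w)\<^sup>2 + lam3 t * ((\<delta> t)\<^sup>2 * (norm f)\<^sup>2 - (norm n)\<^sup>2) \<le> 0"
    using negative_semidefinite_sum_inner_le_0[OF LMI, of u]
    unfolding step sum_4 u power2_norm_eq_inner
    by (simp add: inner_diff_left inner_diff_right inner_add_left
        inner_add_right inner_commute algebra_simps power2_eq_square)
  moreover have "0 \<le> lam4 t * ((L t)\<^sup>2 * (norm e)\<^sup>2 - (norm f)\<^sup>2)"
    using lip assms(17) by simp
  moreover have "0 \<le> 2 * lam1 t * (f \<bullet> e - m t * (norm e)\<^sup>2)"
    using mono assms(14) by simp
  moreover have "lam2 t * (norm w)\<^sup>2 \<le> lam2 t * (\<sigma> t)\<^sup>2"
    using drift assms(15) by (rule mult_left_mono)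
  moreover have "lam3 t * ((norm n)\<^sup>2 - (\<delta> t)\<^sup>2 * (norm f)\<^sup>2) \<le> lam3 t * (c t)\<^sup>2"
    using noise assms(16) by (intro mult_left_mono) auto
  ultimately show ?thesis
    unfolding e_def[symmetric] by (simp add: algebra_simps)
qed

end
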